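(* For each $N\ge2$, the quiver $Q=Q_{D_{2N}}$ is mutation periodic up to the permutation $\rho=(N-1,N)(N+1,N+2,\dots,3N,3N+1)$, that is, $$\mu_N\mu_{N-1}\cdots\mu_1\,\mu_{4N}\mu_{4N-1}\cdots\mu_{3N+2}\,\mu_{N+1}(Q)=\rho(Q).$$
   Context: Mutations act from right to left: first $\mu_{N+1}$, then $\mu_{3N+2},\mu_{3N+3},\dots,\mu_{4N}$, then $\mu_1,\mu_2,\dots,\mu_N$. Quiver mutation $\mu_k$ at a node $k$: for each path $i\to k\to j$ (counted with multiplicity) add an arrow $i\to j$; reverse all arrows incident to $k$; cancel all 2-cycles. Arrows between two frozen nodes are ignored. For a permutation $\rho$ of the nodes (fixing the frozen nodes), $\rho(Q)$ is the quiver having an arrow $\rho(i)\to\rho(j)$ for each arrow $i\to j$ of $Q$. Here $\rho$ is the product of the transposition exchanging $N-1$ and $N$ with the cycle $N+1\mapsto N+2\mapsto\cdots\mapsto 3N+1\mapsto N+1$. Definition of $Q_{D_{2N}}$. It has mutable nodes $1,\dots,4N$ and two frozen nodes $4N+1,4N+2$. Name the mutable nodes as follows: $t_k=N+1+k$ for $0\le k\le 2N$; $c_k=3N+k$ for $2\le k\le N$ and $c_k=k-N$ for $N+1\le k\le 2N-2$ (so $c_2=3N+2,\dots,c_N=4N$, $c_{N+1}=1,\dots,c_{2N-2}=N-2$); and the two remaining nodes are $N-1$ and $N$. The arrows of $Q_{D_{2N}}$ (each with multiplicity one) are: - $t_k\to t_{k+1}$ for $1\le k\le 2N-1$; - $c_k\to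 c_{k+1}$ for $2\le k\le 2N-3$; - $c_k\to t_{k-1}$ and $t_{k+1}\to c_k$ for $2\le k\le 2N-2$; - $c_{2N-2}\to N-1$ and $c_{2N-2}\to N$; - $N-1\to t_{2N-2}$, $N\to t_{2N-2}$, $N-1\to t_{2N-1}$, $N\to t_{2N-1}$; - $t_0\to c_2$, $t_{2N}\to c_2$, $t_2\to t_0$, $t_2\to t_{2N}$, $t_{2N-1}\to t_0$, $t_1\to t_{2N-1}$; - $4N+1\to t_0$, $4N+2\to t_0$, $N\to 4N+1$, $N-1\to 4N+2$. *)

theory Defs
  imports "HOL-Combinatorics.Combinatorics"
begin

text \<open>
  A quiver is given by its arrow multiplicities: \<open>arrows Q i j\<close> is the number of arrows
  \<open>i \<rightarrow> j\<close>. Multiplicities outside \<open>nodes Q\<close> are meant to be 0.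
\<close>

record 'v ice_quiver =
  nodes :: "'v set"
  frozen :: "'v set"
  arrows :: "'v \<Rightarrow> 'v \<Rightarrow> nat"

definition add_paths :: "'v \<Rightarrow> ('v \<Rightarrow> 'v \<Rightarrow> nat) \<Rightarrow> 'v \<Rightarrow> 'v \<Rightarrow> nat" where
  "add_paths k a = (\<lambda>i j. a i j + a i k * a k j)"

definition reverse_at :: "'v \<Rightarrow> ('v \<Rightarrow> 'v \<Rightarrow> nat) \<Rightarrow> 'v \<Rightarrow> 'v \<Rightarrow> nat" where
  "reverse_at k a = (\<lambda>i j. if i = k \<or> j = k then a j i else a i j)"

text \<open>
  Subtraction on \<open>nat\<close> truncates at 0, so this removes a maximal set of disjoint 2-cycles.
\<close>

definition cancel_2cycles :: "('v \<Rightarrow> 'v \<Rightarrow> nat) \<Rightarrow> 'v \<Rightarrow> 'v \<Rightarrow> nat" where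
  "cancel_2cycles a = (\<lambda>i j. a i j - a j i)"

definition drop_between :: "'v set \<Rightarrow> ('v \<Rightarrow> 'v \<Rightarrow> nat) \<Rightarrow> 'v \<Rightarrow> 'v \<Rightarrow> nat" where
  "drop_between F a = (\<lambda>i j. if i \<in> F \<and> j \<in> F then 0 else a i j)"

text \<open>
  Arrows between two frozen nodes are ignored: they are deleted after each mutation.
\<close>

definition mutate :: "'v \<Rightarrow> 'v ice_quiver \<Rightarrow> 'v ice_quiver" where
  "mutate k Q = Q\<lparr>arrows :=
     drop_between (frozen Q) (cancel_2cycles (reverse_at k (add_paths k (arrows Q))))\<rparr>"

text \<open>
  For a bijection \<open>\<rho>\<close>, the arrows \<open>i \<rightarrow> j\<close> of \<open>relabel \<rho> Q\<close> correspond to the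
  arrows \<open>inv \<rho> i \<rightarrow> inv \<rho> j\<close> of \<open>Q\<close>.
\<close>

definition relabel :: "('v \<Rightarrow> 'v) \<Rightarrow> 'v ice_quiver \<Rightarrow> 'v ice_quiver" where
  "relabel \<rho> Q = \<lparr>nodes = \<rho> ` nodes Q, frozen = \<rho> ` frozen Q,
     arrows = (\<lambda>i j. arrows Q (inv \<rho> i) (inv \<rho> j))\<rparr>"

definition t_node :: "nat \<Rightarrow> nat \<Rightarrow> nat" where
  "t_node N k = N + 1 + k"

definition c_node :: "nat \<Rightarrow> nat \<Rightarrow> nat" where
  "c_node N k = (if k \<le> N then 3 * N + k else k - N)"

text \<open>
  For \<open>N \<ge> 2\<close> no arrow is listed twice below, so a set of arrows loses no multiplicity.
\<close>

definition D_arrows :: "nat \<Rightarrow> (nat \<times> nat) set" where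
  "D_arrows N = (let t = t_node N; c = c_node N in
       {(t k, t (k + 1)) | k. 1 \<le> k \<and> k \<le> 2 * N - 1}
     \<union> {(c k, c (k + 1)) | k. 2 \<le> k \<and> k \<le> 2 * N - 3}
     \<union> {(c k, t (k - 1)) | k. 2 \<le> k \<and> k \<le> 2 * N - 2}
     \<union> {(t (k + 1), c k) | k. 2 \<le> k \<and> k \<le> 2 * N - 2}
     \<union> {(c (2 * N - 2), N - 1), (c (2 * N - 2), N)}
     \<union> {(N - 1, t (2 * N - 2)), (N, t (2 * N - 2)), (N - 1, t (2 * N - 1)), (N, t (2 * N - 1))}
     \<union> {(t 0, c 2), (t (2 * N), c 2), (t 2, t 0), (t 2, t (2 * N)),
        (t (2 * N - 1), t 0), (t 1, t (2 * N - 1))}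
     \<union> {(4 * N + 1, t 0), (4 * N + 2, t 0), (N, 4 * N + 1), (N - 1, 4 * N + 2)})"

definition Q_D :: "nat \<Rightarrow> nat ice_quiver" where
  "Q_D N = \<lparr>nodes = {1..4 * N + 2}, frozen = {4 * N + 1, 4 * N + 2},
     arrows = (\<lambda>i j. if (i, j) \<in> D_arrows N then 1 else 0)\<rparr>"

definition rho :: "nat \<Rightarrow> nat \<Rightarrow> nat" where
  "rho N = transpose (N - 1) N \<circ> cycle_of_list [N + 1..<3 * N + 2]"

text \<open>
  The nodes at which one mutates, in chronological order; \<open>fold\<close> applies the head of the
  list first, so this is the composite \<open>\<mu>\<^sub>N \<dots> \<mu>\<^sub>1 \<mu>\<^bsub>4N\<^esub> \<dots> \<mu>\<^bsub>3N+2\<^esub> \<mu>\<^bsub>N+1\<^esub>\<close> read from the right.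
\<close>

definition mutation_order :: "nat \<Rightarrow> nat list" where
  "mutation_order N = [N + 1] @ [3 * N + 2..<4 * N + 1] @ [1..<N + 1]"

end

theory Submission
  imports Defs
begin

text \<open>
  Relabel the nodes by \<open>T k\<close> and \<open>C k\<close> (for \<open>t_k\<close> and \<open>c_k\<close>), two leaves \<open>L e\<close> (for \<open>N - 1\<close>
  and \<open>N\<close>) and two frozen nodes \<open>F e\<close>, and put \<open>m = 2 N - 2\<close>. Then one mutates at \<open>T 0\<close>, at
  \<open>C 2, \<dots>, C m\<close> and at the two leaves. A mutation only changes arrows between neighbours of the
  mutated node, so every intermediate quiver has an explicit form: the mutation at \<open>C k\<close> moves a
  bundle of arrows from the frozen nodes, \<open>T (m + 1)\<close> and \<open>T (m + 2)\<close> from \<open>C k\<close> to \<open>C (k + 1)\<close>,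
  leaving the already shifted pattern behind it, and at the end of the chain the two leaves
  absorb the bundle.
\<close>

section \<open>Explicit quivers along the mutation sequence\<close>

datatype node = T nat | C nat | L bool | F bool

text \<open>Cancellation is built in, so a table \<open>g\<close> may contain 2-cycles and only the
  differences between \<open>g x y\<close> and \<open>g y x\<close> matter.\<close>

definition quiver :: "nat \<Rightarrow> (node \<Rightarrow> node \<Rightarrow> nat) \<Rightarrow> node ice_quiver" where
  "quiver m g =
     \<lparr>nodes = {x. case x of T i \<Rightarrow> i \<le> m + 2 | C i \<Rightarrow> 2 \<le> i \<and> i \<le> m | _ \<Rightarrow> True},
      frozen = range F, arrows = cancel_2cycles g\<rparr>"

fun initial :: "nat \<Rightarrow> node \<Rightarrow> node \<Rightarrow> nat" where
  "initial m (T i) (T j) = of_bool (1 \<le> i \<and> i < m + 2 \<and> j = i + 1 \<or> i = 2 \<and> (j = 0 \<or> j = m + 2) \<or>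
     i = m + 1 \<and> j = 0 \<or> i = 1 \<and> j = m + 1)"
| "initial m (T i) (C j) =
     of_bool (2 \<le> j \<and> j \<le> m \<and> i = j + 1 \<or> j = 2 \<and> (i = 0 \<or> i = m + 2))"
| "initial m (C i) (T j) = of_bool (2 \<le> i \<and> i \<le> m \<and> i = j + 1)"
| "initial m (C i) (C j) = of_bool (2 \<le> i \<and> i < m \<and> j = i + 1)"
| "initial m (C i) (L e) = of_bool (i = m)"
| "initial m (L e) (T j) = of_bool (j = m \<or> j = m + 1)"
| "initial m (F e) (T j) = of_bool (j = 0)"
| "initial m (L e) (F e') = of_bool (e = e')"
| "initial m _ _ = 0"

text \<open>
  The quiver after the mutation at \<open>C k\<close>, for \<open>1 \<le> k < m\<close>, where \<open>k = 1\<close> stands for the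
  mutation at \<open>T 0\<close>. The arrows are listed before cancellation of 2-cycles. For \<open>k = m - 1\<close>
  the arrow \<open>T (m + 1) \<rightarrow> C m\<close> is double, hence sums and not disjunctions of indicators.
\<close>

fun middle :: "nat \<Rightarrow> nat \<Rightarrow> node \<Rightarrow> node \<Rightarrow> nat" where
  "middle m k (T i) (T j) = of_bool (2 \<le> i \<and> i < m + 2 \<and> j = i + 1) + of_bool (i = 2 \<and> j = m + 2)
     + (if k = 1 then of_bool (i = 1 \<and> (j = 2 \<or> j = m + 1) \<or> i = 0 \<and> (j = 2 \<or> j = m + 1))
        else of_bool ((i = 3 \<or> i = m + 2) \<and> (j = 0 \<or> j = 1)))"
| "middle m k (T i) (C j) = of_bool (2 \<le> j \<and> j < k \<and> i = j + 2)
     + of_bool (k \<noteq> 1 \<and> j = 2 \<and> (i = 0 \<or> i = 1))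
     + of_bool (j = k + 1 \<and> (i = m + 1 \<or> i = m + 2 \<or> i = k + 1))
     + of_bool (k < j \<and> j \<le> m \<and> i = j + 1)"
| "middle m k (C i) (T j) = of_bool (2 \<le> i \<and> i \<le> k \<and> j = i)
     + of_bool (k \<noteq> 1 \<and> i = k \<and> (j = m + 1 \<or> j = m + 2 \<or> j = k + 1))
     + of_bool (k + 2 \<le> i \<and> i \<le> m \<and> i = j + 1) + of_bool (k = 1 \<and> i = 2 \<and> (j = 0 \<or> j = 1))"
| "middle m k (C i) (C j) =
     of_bool (2 \<le> i \<and> i < m \<and> j = i + 1 \<and> i \<noteq> k) + of_bool (k \<noteq> 1 \<and> i = k + 1 \<and> j = k)"
| "middle m k (C i) (L e) = of_bool (i = m)"
| "middle m k (C i) (F e) = of_bool (i = k \<and> k \<noteq> 1)"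
| "middle m k (F e) (C i) = of_bool (i = k + 1)"
| "middle m k (L e) (T j) = of_bool (j = m \<or> j = m + 1)"
| "middle m k (F e) (T j) = of_bool (j = 1 \<and> k \<noteq> 1)"
| "middle m k (T j) (F e) = of_bool (j = 0 \<and> k = 1)"
| "middle m k (L e) (F e') = of_bool (e = e')"
| "middle m k _ _ = 0"

text \<open>
  The quiver after the mutation at \<open>C m\<close> and at the leaves \<open>L e\<close> with \<open>u e\<close>.
\<close>

fun final :: "nat \<Rightarrow> (bool \<Rightarrow> bool) \<Rightarrow> node \<Rightarrow> node \<Rightarrow> nat" where
  "final m u (T i) (T j) = of_bool (2 \<le> i \<and> i < m + 2 \<and> j = i + 1) + of_bool (i = 2 \<and> j = m + 2)
     + of_bool ((i = 3 \<or> i = m + 2) \<and> (j = 0 \<or> j = 1))"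
| "final m u (T i) (C j) = of_bool (2 \<le> j \<and> j \<le> m \<and> i = j + 2) + of_bool (j = 2 \<and> (i = 0 \<or> i = 1))"
| "final m u (C i) (T j) = of_bool (2 \<le> i \<and> i \<le> m \<and> j = i)
     + (of_bool (\<not> u True) + of_bool (\<not> u False)) * of_bool (i = m \<and> (j = m + 1 \<or> j = m + 2))"
| "final m u (C i) (C j) = of_bool (2 \<le> i \<and> i < m \<and> j = i + 1)"
| "final m u (C i) (L e) = of_bool (u e \<and> i = m)"
| "final m u (L e) (C i) = of_bool (\<not> u e \<and> i = m)"
| "final m u (C i) (F e) = of_bool (\<not> u (\<not> e) \<and> i = m)"
| "final m u (L e) (T j) = of_bool (u e \<and> (j = m + 1 \<or> j = m + 2))"
| "final m u (T j) (L e) = of_bool (\<not> u e \<and> (j = m + 1 \<or> j = m + 2))"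
| "final m u (F e) (T j) = of_bool (j = 1)"
| "final m u (L e) (F e') = of_bool (u e \<and> e \<noteq> e')"
| "final m u (F e') (L e) = of_bool (\<not> u e \<and> e \<noteq> e')"
| "final m u _ _ = 0"

section \<open>The exchange relation and the single mutations\<close>

text \<open>
  The exchange relation between the signed arrow counts \<open>g x y - g y x\<close> and \<open>g' x y - g' y x\<close>,
  with the negative terms moved to the other side to avoid truncated subtraction.
\<close>

definition mutation_eq :: "node \<Rightarrow> (node \<Rightarrow> node \<Rightarrow> nat) \<Rightarrow> (node \<Rightarrow> node \<Rightarrow> nat) \<Rightarrow> node \<Rightarrow> node \<Rightarrow> bool"
  where "mutation_eq z g g' x y \<longleftrightarrow>
     g x y + g x z * g z y + g' y x = g' x y + g y x + g y z * g z x"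

lemma mutation_eq_sym: "mutation_eq z g g' y x \<Longrightarrow> mutation_eq z g g' x y"
  by (simp add: mutation_eq_def)

text \<open>Without 2-cycles at \<open>z\<close>, the products \<open>g x z * g z y\<close> count
  the actual paths through \<open>z\<close>, and \<open>row\<close> expresses the reversal at
  \<open>z\<close>. The exchange relation is symmetric in \<open>x\<close> and \<open>y\<close>, so
  one order of each pair of constructors suffices.\<close>

lemma mutate_quiverI:
  assumes no_2cycle: "\<And>x. g x z = 0 \<or> g z x = 0"
    and row: "\<And>x. g' z x + g z x = g x z + g' x z"
    and z: "z \<notin> range F" and FF: "\<And>e e'. g' (F e) (F e') = 0"
    and TT: "\<And>i j. T i \<noteq> z \<Longrightarrow> T j \<noteq> z \<Longrightarrow> mutation_eq z g g' (T i) (T j)"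
    and CT: "\<And>i j. C i \<noteq> z \<Longrightarrow> T j \<noteq> z \<Longrightarrow> mutation_eq z g g' (C i) (T j)"
    and CC: "\<And>i j. C i \<noteq> z \<Longrightarrow> C j \<noteq> z \<Longrightarrow> mutation_eq z g g' (C i) (C j)"
    and LT: "\<And>e j. L e \<noteq> z \<Longrightarrow> T j \<noteq> z \<Longrightarrow> mutation_eq z g g' (L e) (T j)"
    and LC: "\<And>e j. L e \<noteq> z \<Longrightarrow> C j \<noteq> z \<Longrightarrow> mutation_eq z g g' (L e) (C j)"
    and LL: "\<And>e e'. L e \<noteq> z \<Longrightarrow> L e' \<noteq> z \<Longrightarrow> mutation_eq z g g' (L e) (L e')"
    and FT: "\<And>e j. T j \<noteq> z \<Longrightarrow> mutation_eq z g g' (F e) (T j)"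
    and FC: "\<And>e j. C j \<noteq> z \<Longrightarrow> mutation_eq z g g' (F e) (C j)"
    and FL: "\<And>e e'. L e' \<noteq> z \<Longrightarrow> mutation_eq z g g' (F e) (L e')"
  shows "mutate z (quiver m g) = quiver m g'"
proof -
  have at_z: "g x z - g z x = g x z" "g z x - g x z = g z x" for x
    using no_2cycle[of x] by auto
  have "drop_between (range F) (cancel_2cycles (reverse_at z (add_paths z (cancel_2cycles g)))) x y =
    cancel_2cycles g' x y" for x y
  proof (cases "x = z \<or> y = z")
    case True
    then show ?thesis
      using z row[of x] row[of y] no_2cycle[of x] no_2cycle[of y] no_2cycle[of z]
      by (auto simp: drop_between_def cancel_2cycles_def reverse_at_def add_paths_def)
  next
    case False
    have "mutation_eq z g g' x y" if "\<not> (x \<in> range F \<and> y \<in> range F)"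
      using that False
      by (cases x; cases y) (auto intro: TT CT CC LT LC LL FT FC FL mutation_eq_sym[OF CT]
        mutation_eq_sym[OF LT] mutation_eq_sym[OF LC] mutation_eq_sym[OF FT] mutation_eq_sym[OF FC]
        mutation_eq_sym[OF FL])
    then show ?thesis
      using False FF
      by (auto simp: drop_between_def reverse_at_def add_paths_def at_z mutation_eq_def cancel_2cycles_def)
  qed
  then show ?thesis
    by (simp add: mutate_def quiver_def fun_eq_iff)
qed

text \<open>The only arrow out of \<open>T 0\<close> goes to \<open>C 2\<close>, so every new arrow
  ends at \<open>C 2\<close>; this completes the first bundle.\<close>

lemma mutate_initial:
  assumes "2 \<le> m"
  shows "mutate (T 0) (quiver m (initial m)) = quiver m (middle m 1)"
proof (rule mutate_quiverI, goal_cases)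
  case (1 x) then show ?case using assms by (cases x) auto
next
  case (2 x) then show ?case using assms by (cases x) auto
next
  \<comment> \<open>Goals 5, 6 and 7 of \<open>mutate_quiverI\<close> are \<open>TT\<close>,
    \<open>CT\<close> and \<open>CC\<close>.\<close>
  case (5 i j)
  then show ?case using assms
    by (cases "i = 1"; cases "j = 1"; auto simp: mutation_eq_def)
next
  case (6 i j)
  then show ?case using assms by (cases "i = 2"; auto simp: mutation_eq_def)
qed (use assms in \<open>auto simp: mutation_eq_def\<close>)

lemma mutate_middle:
  assumes "1 \<le> k" "k + 1 < m"
  shows "mutate (C (k + 1)) (quiver m (middle m k)) = quiver m (middle m (k + 1))"
proof (rule mutate_quiverI, goal_cases)
  case (1 x) then show ?case using assms by (cases x; cases "k = 1"; auto)
next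
  case (2 x) then show ?case using assms by (cases x; cases "k = 1"; auto)
next
  case (5 i j)
  show ?case
  proof (cases "k = 1")
    case True
    then show ?thesis using assms
      by (cases "i = 0 \<or> i = 1"; cases "j = 0 \<or> j = 1"; auto simp: mutation_eq_def)
  next
    case False
    then show ?thesis using assms by (simp add: mutation_eq_def)
  qed
next
  case (6 i j)
  then consider "i < k" | "i = k" | "i = k + 2" | "k + 2 < i" by fastforce
  then show ?case using assms
    by cases (cases "k = 1"; auto simp: mutation_eq_def)+
next
  case (7 i j)
  then show ?case using assms
    by (cases "i = k"; cases "j = k"; cases "i = k + 2"; cases "j = k + 2"; auto simp: mutation_eq_def)
qed (use assms in \<open>auto simp: mutation_eq_def\<close>)

text \<open>Now \<open>C m\<close> with \<open>m = k + 1\<close> points to both leaves, and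
  \<open>T (k + 2)\<close> is \<open>T (m + 1)\<close>, whose arrow to \<open>C m\<close> is double:
  of the two paths to each leaf, one cancels the arrow from that leaf and one survives.\<close>

lemma mutate_last_C:
  assumes "1 \<le> k"
  shows "mutate (C (k + 1)) (quiver (k + 1) (middle (k + 1) k)) = quiver (k + 1) (final (k + 1) (\<lambda>_. False))"
proof (rule mutate_quiverI, goal_cases)
  case (1 x) then show ?case using assms by (cases x; cases "k = 1"; auto)
next
  case (2 x) then show ?case using assms by (cases x; cases "k = 1"; auto)
next
  case (5 i j)
  show ?case
  proof (cases "k = 1")
    case True
    then show ?thesis
      by (cases "i = 0 \<or> i = 1"; cases "j = 0 \<or> j = 1"; auto simp: mutation_eq_def)
  next
    case False
    then show ?thesis using assms by (simp add: mutation_eq_def)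
  qed
next
  case (6 i j)
  then consider "i < k" | "i = k" | "k + 1 < i" by fastforce
  then show ?case using assms
    by cases (cases "k = 1"; auto simp: mutation_eq_def)+
next
  case (7 i j)
  then show ?case using assms
    by (cases "i = k"; cases "j = k"; auto simp: mutation_eq_def)
qed (use assms in \<open>auto simp: mutation_eq_def\<close>)

text \<open>The only arrow out of \<open>L e\<close> goes to \<open>C m\<close>, and the paths from
  \<open>T (m + 1)\<close>, \<open>T (m + 2)\<close> and \<open>F (\<not> e)\<close> each cancel one
  arrow leaving \<open>C m\<close>.\<close>

lemma mutate_final:
  assumes "2 \<le> m" "\<not> u e"
  shows "mutate (L e) (quiver m (final m u)) = quiver m (final m (u(e := True)))"
proof (rule mutate_quiverI, goal_cases)
  case (1 x) then show ?case using assms by (cases x) auto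
next
  case (2 x) then show ?case using assms by (cases x; cases e; auto)
next
  case (6 i j)
  then show ?case using assms by (cases e; cases "i = m"; auto simp: mutation_eq_def)
qed (use assms in \<open>auto simp: mutation_eq_def\<close>)

lemma fold_mutate_middle:
  assumes "1 \<le> k" "k < m"
  shows "fold mutate (map C [2..<k + 1]) (quiver m (middle m 1)) = quiver m (middle m k)"
  using assms
proof (induction k rule: dec_induct)
  case base
  show ?case by simp
next
  case (step k)
  then show ?case using mutate_middle[of k m] by simp
qed

lemma fold_mutate_quiver:
  assumes "2 \<le> m"
  shows "fold mutate (T 0 # map C [2..<m + 1] @ [L True, L False]) (quiver m (initial m)) =
    quiver m (final m (\<lambda>_. True))"
proof -
  \<comment> \<open>The mutation at \<open>C m\<close> is split off because
    \<open>mutate_last_C\<close> handles it; for \<open>m = 2\<close> the prefix is empty.\<close>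
  have "[2..<m + 1] = [2..<(m - 1) + 1] @ [(m - 1) + 1]"
    using assms upt_Suc_append[of 2 m] by simp
  moreover have "(\<lambda>_. False)(True := True, False := True) = (\<lambda>_. True)"
    by (auto simp: fun_eq_iff)
  ultimately show ?thesis
    using assms fold_mutate_middle[of "m - 1" m] mutate_last_C[of "m - 1"]
    by (simp add: mutate_initial mutate_final del: upt_Suc One_nat_def)
qed

section \<open>Comparison of the last quiver with the first\<close>

text \<open>
  The permutation \<open>rho N\<close> in terms of labels.
\<close>

fun shift :: "nat \<Rightarrow> node \<Rightarrow> node" where
  "shift m (T i) = (if i < m + 2 then T (i + 1) else if i = m + 2 then T 0 else T i)"
| "shift m (L e) = L (\<not> e)"
| "shift m x = x"

lemma bij_shift: "bij (shift m)"
proof (rule o_bij)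
  define inv_shift where "inv_shift x = (case x of
      T i \<Rightarrow> if i = 0 then T (m + 2) else if i \<le> m + 2 then T (i - 1) else T i
    | L e \<Rightarrow> L (\<not> e) | _ \<Rightarrow> x)" for x
  show "inv_shift \<circ> shift m = id"
  proof
    fix x show "(inv_shift \<circ> shift m) x = id x"
      by (cases x) (auto simp: inv_shift_def)
  qed
  show "shift m \<circ> inv_shift = id"
  proof
    fix x show "(shift m \<circ> inv_shift) x = id x"
      by (cases x) (auto simp: inv_shift_def)
  qed
qed

text \<open>Once both leaves are mutated, all terms with \<open>\<not> u e\<close> vanish and the
  tables agree entry by entry, even before cancellation.\<close>

lemma final_shift:
  assumes "2 \<le> m"
  shows "final m (\<lambda>_. True) (shift m x) (shift m y) = initial m x y"
proof (cases x; cases y)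
  fix i j
  assume "x = T i" "y = T j"
  then show ?thesis
    using assms by (cases "i = m + 1"; cases "i = 1"; cases "i = 2"; auto)
qed (use assms in auto)

lemma frozen_quiver: "frozen (quiver m g) = range F"
  and arrows_quiver: "arrows (quiver m g) = cancel_2cycles g"
  by (simp_all add: quiver_def)

lemma relabel_shift:
  assumes "2 \<le> m"
  shows "relabel (shift m) (quiver m (initial m)) = quiver m (final m (\<lambda>_. True))"
proof -
  have image: "shift m ` A = A" if "\<And>x. shift m x \<in> A \<longleftrightarrow> x \<in> A" for A
    using that surj_f_inv_f[OF bij_is_surj[OF bij_shift]] by (metis image_subsetI image_eqI subsetI subset_antisym)
  have "shift m ` nodes (quiver m g) = nodes (quiver m g)" for g
  proof (rule image)
    show "shift m x \<in> nodes (quiver m g) \<longleftrightarrow> x \<in> nodes (quiver m g)" for x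
      by (cases x) (auto simp: quiver_def)
  qed
  moreover have "nodes (quiver m (initial m)) = nodes (quiver m (final m (\<lambda>_. True)))"
    by (simp add: quiver_def)
  moreover have "shift m ` range F = range F"
  proof (rule image)
    show "shift m x \<in> range F \<longleftrightarrow> x \<in> range F" for x by (cases x) auto
  qed
  moreover have "initial m (inv (shift m) x) (inv (shift m) y) = final m (\<lambda>_. True) x y" for x y
    using final_shift[OF assms, of "inv (shift m) x" "inv (shift m) y"]
    by (simp add: bij_shift bij_is_surj surj_f_inv_f)
  ultimately show ?thesis
    by (intro ice_quiver.equality) (simp_all add: relabel_def frozen_quiver arrows_quiver cancel_2cycles_def)
qed

section \<open>Pullback of quivers along an injection\<close>

definition pullback :: "('a \<Rightarrow> 'b) \<Rightarrow> 'b ice_quiver \<Rightarrow> 'a ice_quiver" where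
  "pullback h Q = \<lparr>nodes = h -` nodes Q, frozen = h -` frozen Q,
     arrows = (\<lambda>i j. arrows Q (h i) (h j))\<rparr>"

text \<open>Mutation tests nodes only for equality with \<open>k\<close> and for being frozen, and
  \<open>inj h\<close> reflects equality. This covers \<open>decode N\<close>, which is not
  onto.\<close>

lemma mutate_pullback:
  assumes "inj h"
  shows "mutate k (pullback h Q) = pullback h (mutate (h k) Q)"
  using assms
  by (auto simp: mutate_def pullback_def drop_between_def cancel_2cycles_def reverse_at_def
      add_paths_def fun_eq_iff inj_eq)

lemma fold_mutate_pullback:
  assumes "inj h"
  shows "fold mutate ks (pullback h Q) = pullback h (fold mutate (map h ks) Q)"
  by (induction ks arbitrary: Q) (simp_all add: mutate_pullback[OF assms])

lemma relabel_pullback: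
  assumes "bij r" "bij s" "\<And>i. h (r i) = s (h i)"
  shows "relabel r (pullback h Q) = pullback h (relabel s Q)"
proof -
  have inv: "h (inv r i) = inv s (h i)" for i
  proof -
    have "s (h (inv r i)) = h i"
      using assms by (simp add: bij_is_surj surj_f_inv_f flip: assms(3))
    then show ?thesis
      using assms(2) by (simp add: bij_inv_eq_iff)
  qed
  \<comment> \<open>Images under the bijections become preimages under their inverses, which
    \<open>h\<close> intertwines as well.\<close>
  have "r ` (h -` X) = h -` s ` X" for X
  proof -
    have "r ` (h -` X) = inv r -` (h -` X)"
      using assms(1) by (simp add: bij_vimage_eq_inv_image bij_imp_bij_inv inv_inv_eq)
    also have "\<dots> = h -` (inv s -` X)"
      by (auto simp: inv)
    also have "\<dots> = h -` s ` X"
      using assms(2) by (simp add: bij_vimage_eq_inv_image bij_imp_bij_inv inv_inv_eq)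
    finally show ?thesis .
  qed
  then show ?thesis
    by (simp add: relabel_def pullback_def inv)
qed

section \<open>Translation between numbers and labels\<close>

text \<open>
  The branches \<open>v = 0\<close> and \<open>T v\<close> label the numbers that are not nodes by unused labels; this makes
  \<open>decode N\<close> injective on all of \<open>nat\<close>, so that \<open>Q_D N\<close> is a pullback along it.
\<close>

definition decode :: "nat \<Rightarrow> nat \<Rightarrow> node" where
  "decode N v =
     (if N + 1 \<le> v \<and> v \<le> 3 * N + 1 then T (v - (N + 1))
      else if 3 * N + 2 \<le> v \<and> v \<le> 4 * N then C (v - 3 * N)
      else if v = N - 1 then L True
      else if v = N then L False
      else if v = 4 * N + 1 then F False
      else if v = 4 * N + 2 then F True
      else if v = 0 then T (2 * N + 1)
      else if v < N then C (v + N)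
      else T v)"

text \<open>A left inverse of \<open>decode N\<close>; only its values on the range of
  \<open>decode N\<close> matter.\<close>

fun encode :: "nat \<Rightarrow> node \<Rightarrow> nat" where
  "encode N (T k) = (if k \<le> 2 * N then t_node N k else if k = 2 * N + 1 then 0 else k)"
| "encode N (C k) = c_node N k"
| "encode N (L e) = (if e then N - 1 else N)"
| "encode N (F e) = (if e then 4 * N + 2 else 4 * N + 1)"

lemma encode_decode: "2 \<le> N \<Longrightarrow> encode N (decode N v) = v"
  by (auto simp: decode_def t_node_def c_node_def)

lemma inj_decode: "2 \<le> N \<Longrightarrow> inj (decode N)"
  by (rule inj_on_inverseI) (rule encode_decode)

lemma decode_t_node: "k \<le> 2 * N \<Longrightarrow> decode N (t_node N k) = T k"
  by (simp add: decode_def t_node_def)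

lemma decode_c_node: "2 \<le> k \<Longrightarrow> k \<le> 2 * N - 2 \<Longrightarrow> decode N (c_node N k) = C k"
  by (auto simp: decode_def c_node_def)

lemma decode_leaves:
  assumes "2 \<le> N"
  shows "decode N (N - 1) = L True" "decode N N = L False"
    "decode N (4 * N + 1) = F False" "decode N (4 * N + 2) = F True"
  using assms by (auto simp: decode_def)

section \<open>The arrows of \<open>Q_D N\<close> in terms of labels\<close>

lemma D_arrows_TT:
  assumes "1 \<le> k" "k \<le> 2 * N - 1"
  shows "(t_node N k, t_node N (k + 1)) \<in> D_arrows N"
proof -
  have "(t_node N k, t_node N (k + 1)) \<in> {(t_node N k, t_node N (k + 1)) | k. 1 \<le> k \<and> k \<le> 2 * N - 1}"
    using assms by blast
  then show ?thesis
    unfolding D_arrows_def Let_def by (simp only: Un_iff simp_thms)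
qed

lemma D_arrows_CC:
  assumes "2 \<le> k" "k \<le> 2 * N - 3"
  shows "(c_node N k, c_node N (k + 1)) \<in> D_arrows N"
proof -
  have "(c_node N k, c_node N (k + 1)) \<in> {(c_node N k, c_node N (k + 1)) | k. 2 \<le> k \<and> k \<le> 2 * N - 3}"
    using assms by blast
  then show ?thesis
    unfolding D_arrows_def Let_def by (simp only: Un_iff simp_thms)
qed

lemma D_arrows_CT:
  assumes "2 \<le> k" "k \<le> 2 * N - 2"
  shows "(c_node N k, t_node N (k - 1)) \<in> D_arrows N"
proof -
  have "(c_node N k, t_node N (k - 1)) \<in> {(c_node N k, t_node N (k - 1)) | k. 2 \<le> k \<and> k \<le> 2 * N - 2}"
    using assms by blast
  then show ?thesis
    unfolding D_arrows_def Let_def by (simp only: Un_iff simp_thms)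
qed

lemma D_arrows_TC:
  assumes "2 \<le> k" "k \<le> 2 * N - 2"
  shows "(t_node N (k + 1), c_node N k) \<in> D_arrows N"
proof -
  have "(t_node N (k + 1), c_node N k) \<in> {(t_node N (k + 1), c_node N k) | k. 2 \<le> k \<and> k \<le> 2 * N - 2}"
    using assms by blast
  then show ?thesis
    unfolding D_arrows_def Let_def by (simp only: Un_iff simp_thms)
qed

lemma D_arrows_special:
  "(c_node N (2 * N - 2), N - 1) \<in> D_arrows N" "(c_node N (2 * N - 2), N) \<in> D_arrows N"
  "(N - 1, t_node N (2 * N - 2)) \<in> D_arrows N" "(N, t_node N (2 * N - 2)) \<in> D_arrows N"
  "(N - 1, t_node N (2 * N - 1)) \<in> D_arrows N" "(N, t_node N (2 * N - 1)) \<in> D_arrows N"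
  "(t_node N 0, c_node N 2) \<in> D_arrows N" "(t_node N (2 * N), c_node N 2) \<in> D_arrows N"
  "(t_node N 2, t_node N 0) \<in> D_arrows N" "(t_node N 2, t_node N (2 * N)) \<in> D_arrows N"
  "(t_node N (2 * N - 1), t_node N 0) \<in> D_arrows N"
  "(t_node N 1, t_node N (2 * N - 1)) \<in> D_arrows N"
  "(4 * N + 1, t_node N 0) \<in> D_arrows N" "(4 * N + 2, t_node N 0) \<in> D_arrows N"
  "(N, 4 * N + 1) \<in> D_arrows N" "(N - 1, 4 * N + 2) \<in> D_arrows N"
  by (simp_all add: D_arrows_def Let_def)

text \<open>The converse of \<open>initial_decode\<close>. Passing through \<open>encode\<close>
  gives each table entry explicit endpoints, so the membership facts for the single families
  apply.\<close>

lemma D_arrows_encode: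
  assumes "2 \<le> N" "initial (2 * N - 2) x y \<noteq> 0"
  shows "(encode N x, encode N y) \<in> D_arrows N"
proof -
  have m: "2 * N - 2 + 2 = 2 * N" "2 * N - 2 + 1 = 2 * N - 1"
    using assms(1) by auto
  show ?thesis
  proof (cases x; cases y)
    fix i j
    assume xy: "x = T i" "y = T j"
    have "1 \<le> i \<and> i \<le> 2 * N - 1 \<and> j = i + 1 \<or> i = 2 \<and> (j = 0 \<or> j = 2 * N) \<or>
        i = 2 * N - 1 \<and> j = 0 \<or> i = 1 \<and> j = 2 * N - 1"
      using assms(2) unfolding xy initial.simps m of_bool_eq_0_iff by linarith
    then consider "1 \<le> i" "i \<le> 2 * N - 1" "j = i + 1" | "i = 2" "j = 0" | "i = 2" "j = 2 * N"
      | "i = 2 * N - 1" "j = 0" | "i = 1" "j = 2 * N - 1"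
      by blast
    then show ?thesis
      using assms(1) D_arrows_TT[of i N] D_arrows_special[of N] by cases (auto simp: xy)
  next
    fix i j
    assume xy: "x = T i" "y = C j"
    have "2 \<le> j \<and> j \<le> 2 * N - 2 \<and> i = j + 1 \<or> j = 2 \<and> (i = 0 \<or> i = 2 * N)"
      using assms(2) unfolding xy initial.simps m of_bool_eq_0_iff by blast
    then consider "2 \<le> j" "j \<le> 2 * N - 2" "i = j + 1" | "i = 0" "j = 2" | "i = 2 * N" "j = 2"
      by blast
    then show ?thesis
      using assms(1) D_arrows_TC[of j N] D_arrows_special[of N] by cases (auto simp: xy)
  next
    fix i j
    assume xy: "x = C i" "y = T j"
    then have "2 \<le> i" "i \<le> 2 * N - 2" "i = j + 1" using assms(2) by auto
    then show ?thesis
      using D_arrows_CT[of i N] xy by auto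
  next
    fix i j
    assume xy: "x = C i" "y = C j"
    then have "2 \<le> i" "i \<le> 2 * N - 3" "j = i + 1" using assms(2) by auto
    then show ?thesis
      using D_arrows_CC[of i N] xy by auto
  next
    fix e j
    assume xy: "x = L e" "y = T j"
    then consider "j = 2 * N - 2" | "j = 2 * N - 1"
      using assms(2) unfolding xy initial.simps m of_bool_eq_0_iff by blast
    then show ?thesis
      using D_arrows_special[of N] by cases (auto simp: xy)
  next
    fix i e
    assume xy: "x = C i" "y = L e"
    then have "i = 2 * N - 2" using assms(2) by simp
    then show ?thesis
      using D_arrows_special[of N] xy by simp
  next
    fix e j
    assume xy: "x = F e" "y = T j"
    then have "j = 0" using assms(2) by simp
    then show ?thesis
      using D_arrows_special[of N] xy by simp
  next
    fix e e'
    assume xy: "x = L e" "y = F e'"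
    then have "e = e'" using assms(2) by simp
    then show ?thesis
      using D_arrows_special[of N] xy by simp
  qed (use assms in auto)
qed

lemma initial_decode:
  assumes "2 \<le> N" "(i, j) \<in> D_arrows N"
  shows "initial (2 * N - 2) (decode N i) (decode N j) = 1"
  using assms(2)[unfolded D_arrows_def Let_def] assms(1)
  \<comment> \<open>Simplification rewrites \<open>N - 1\<close> and \<open>4 * N + 1\<close> with
    \<open>Suc\<close>; the simplified copy matches these forms.\<close>
  by (auto simp: decode_t_node decode_c_node decode_leaves decode_leaves[simplified])

text \<open>Makes the cancellation inside \<open>quiver\<close> vacuous for the starting
  table.\<close>

lemma initial_asym:
  assumes "2 \<le> m"
  shows "initial m x y = 0 \<or> initial m y x = 0"
  using assms by (cases x; cases y; auto)

lemma decode_in_nodes: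
  assumes "2 \<le> N"
  shows "decode N v \<in> nodes (quiver (2 * N - 2) g) \<longleftrightarrow> 1 \<le> v \<and> v \<le> 4 * N + 2"
    and "decode N v \<in> range F \<longleftrightarrow> v = 4 * N + 1 \<or> v = 4 * N + 2"
proof -
  consider "v = 0" | "v = N - 1" | "v = N" | "1 \<le> v" "v < N - 1" | "N + 1 \<le> v" "v \<le> 3 * N + 1"
    | "3 * N + 2 \<le> v" "v \<le> 4 * N" | "v = 4 * N + 1" | "v = 4 * N + 2" | "4 * N + 2 < v"
    by linarith
  then have "(decode N v \<in> nodes (quiver (2 * N - 2) g) \<longleftrightarrow> 1 \<le> v \<and> v \<le> 4 * N + 2) \<and>
    (decode N v \<in> range F \<longleftrightarrow> v = 4 * N + 1 \<or> v = 4 * N + 2)"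
    using assms by cases (auto simp: quiver_def decode_def)
  then show "decode N v \<in> nodes (quiver (2 * N - 2) g) \<longleftrightarrow> 1 \<le> v \<and> v \<le> 4 * N + 2"
    and "decode N v \<in> range F \<longleftrightarrow> v = 4 * N + 1 \<or> v = 4 * N + 2"
    by auto
qed

lemma initial_le_1: "initial m x y \<le> 1"
  by (cases "(m, x, y)" rule: initial.cases) simp_all

text \<open>Both sides have only multiplicities 0 and 1, so it suffices to compare which arrows are
  present.\<close>

lemma Q_D_eq_pullback:
  assumes "2 \<le> N"
  shows "Q_D N = pullback (decode N) (quiver (2 * N - 2) (initial (2 * N - 2)))"
proof -
  let ?m = "2 * N - 2"
  have arrows: "(if (i, j) \<in> D_arrows N then 1 else 0) =
      cancel_2cycles (initial ?m) (decode N i) (decode N j)" for i j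
  proof -
    let ?x = "decode N i" and ?y = "decode N j"
    have "(i, j) \<in> D_arrows N \<longleftrightarrow> initial ?m ?x ?y \<noteq> 0"
      using initial_decode[OF assms, of i j] D_arrows_encode[OF assms, of ?x ?y]
      unfolding encode_decode[OF assms] by (metis zero_neq_one)
    moreover have "cancel_2cycles (initial ?m) ?x ?y = initial ?m ?x ?y"
      using initial_asym[of ?m ?x ?y] assms unfolding cancel_2cycles_def by linarith
    ultimately show ?thesis using initial_le_1[of ?m ?x ?y] by simp
  qed
  show ?thesis
    by (intro ice_quiver.equality set_eqI ext)
      (simp_all add: Q_D_def pullback_def arrows decode_in_nodes[OF assms] frozen_quiver arrows_quiver)
qed

section \<open>Mutation order and permutation in terms of labels\<close>

lemma map_decode_mutation_order:
  assumes "2 \<le> N"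
  shows "map (decode N) (mutation_order N) = T 0 # map C [2..<2 * N - 2 + 1] @ [L True, L False]"
proof -
  have leaves: "[1..<N + 1] = [1..<N - 1] @ [N - 1, N]"
  proof -
    have "[1..<N + 1] = [1..<N - 1] @ [N - 1..<N + 1]"
      using assms upt_add_eq_append[of 1 "N - 1" 2] by simp
    also have "[N - 1..<N + 1] = [N - 1, N]"
      using assms by (simp add: upt_conv_Cons)
    finally show ?thesis .
  qed
  \<comment> \<open>The two blocks of numbers traverse the chain from \<open>C 2\<close> to
    \<open>C (2 * N - 2)\<close> without a gap; the second is empty for
    \<open>N = 2\<close>.\<close>
  have first: "map (decode N) [3 * N + 2..<4 * N + 1] = map C [2..<N + 1]"
    by (rule nth_equalityI) (auto simp: decode_def simp del: upt_Suc)
  have second: "map (decode N) [1..<N - 1] = map C [N + 1..<2 * N - 2 + 1]"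
    using assms by (intro nth_equalityI) (auto simp: decode_def simp del: upt_Suc)
  have "[2..<2 * N - 2 + 1] = [2..<N + 1] @ [N + 1..<2 * N - 2 + 1]"
    using assms upt_add_eq_append[of 2 "N + 1" "N - 2"] by (simp add: mult_2 del: upt_Suc)
  moreover have "decode N (N + 1) = T 0"
    by (simp add: decode_def)
  ultimately show ?thesis
    unfolding mutation_order_def leaves map_append first second
    using assms decode_leaves by simp
qed

lemma bij_rho: "bij (rho N)"
proof -
  have "cycle_of_list [N + 1..<3 * N + 2] permutes set [N + 1..<3 * N + 2]"
    by (rule cycle_permutes)
  then have "bij (cycle_of_list [N + 1..<3 * N + 2])"
    by (rule permutes_bij)
  then show ?thesis
    unfolding rho_def by (intro bij_comp bij_transpose)
qed

lemma cycle_of_list_upt: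
  assumes "a < b"
  shows "cycle_of_list [a..<b] v = (if a \<le> v \<and> v + 1 < b then v + 1 else if v + 1 = b then a else v)"
proof (cases "a \<le> v \<and> v < b")
  case True
  \<comment> \<open>One application of the cycle to its own list of distinct entries rotates the
    list by one place.\<close>
  have "map (cycle_of_list [a..<b]) [a..<b] = rotate1 [a..<b]"
    by (rule cyclic_rotation[of _ 1, simplified]) simp
  then have "cycle_of_list [a..<b] v = rotate1 [a..<b] ! (v - a)"
    using True by (metis le_add_diff_inverse length_upt nth_map nth_upt diff_less_mono)
  then show ?thesis
    using True assms by (auto simp: nth_rotate1 mod_Suc)
next
  case False
  then show ?thesis
    using assms id_outside_supp[of v "[a..<b]"] by auto
qed

text \<open>Numbers that are not nodes carry labels \<open>T i\<close> with
  \<open>i > 2 * N\<close>; \<open>shift\<close> fixes these just as \<open>rho N\<close> fixes the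
  numbers, so the identity holds on all of \<open>nat\<close>.\<close>

lemma decode_rho:
  assumes "2 \<le> N"
  shows "decode N (rho N v) = shift (2 * N - 2) (decode N v)"
proof -
  have rho: "rho N v = transpose (N - 1) N
      (if N + 1 \<le> v \<and> v \<le> 3 * N then v + 1 else if v = 3 * N + 1 then N + 1 else v)"
    using assms by (simp add: rho_def cycle_of_list_upt del: upt_Suc)
  consider "N + 1 \<le> v" "v \<le> 3 * N" | "v = 3 * N + 1" | "v = N - 1" | "v = N"
    | "v < N - 1" | "3 * N + 1 < v"
    by linarith
  then show ?thesis
  proof cases
    case 1
    then have "rho N v = v + 1" by (simp add: rho)
    with 1 assms show ?thesis by (auto simp: decode_def)
  next
    case 2
    then have "rho N v = N + 1" unfolding rho by simp
    with 2 assms show ?thesis by (auto simp: decode_def)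
  next
    case 3
    then have "rho N v = N" unfolding rho using assms by simp
    with 3 assms show ?thesis by (simp add: decode_leaves decode_leaves[simplified])
  next
    case 4
    then have "rho N v = N - 1" unfolding rho using assms by simp
    with 4 assms show ?thesis by (simp add: decode_leaves decode_leaves[simplified])
  next
    case 5
    then have "rho N v = v" using assms by (auto simp: rho)
    with 5 assms show ?thesis by (auto simp: decode_def)
  next
    case 6
    then have "rho N v = v" using assms by (auto simp: rho)
    with 6 assms show ?thesis by (auto simp: decode_def)
  qed
qed

theorem proposition6p1:
  fixes N :: nat
  assumes "N \<ge> 2"
  shows "fold mutate (mutation_order N) (Q_D N) = relabel (rho N) (Q_D N)"
proof -
  let ?m = "2 * N - 2"
  have m: "2 \<le> ?m" using assms by simp
  have "fold mutate (mutation_order N) (Q_D N) =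
      pullback (decode N) (quiver ?m (final ?m (\<lambda>_. True)))"
    using assms
    by (simp only: Q_D_eq_pullback fold_mutate_pullback inj_decode map_decode_mutation_order
        fold_mutate_quiver[OF m])
  also have "\<dots> = relabel (rho N) (Q_D N)"
    using relabel_pullback[OF bij_rho bij_shift, of "decode N" N ?m, OF decode_rho[OF assms]]
    by (simp only: Q_D_eq_pullback[OF assms] relabel_shift[OF m])
  finally show ?thesis .
qed

end
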